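(* Let $N\ge 2$ and $s_N=\frac{1}{\sqrt{N^2+1}}$. Let $\tilde T_n$ ($0\le n\le N$) denote the quantities computed by the three-term recursion algorithm ($T_0=1$, $T_1=x$, $T_n=2xT_{n-1}-T_{n-2}$ for $n=2,\ldots,N$) in floating point arithmetic with machine precision $\epsilon_M$, and let $\tilde T_N(x)=\tilde T_N$ be its output. Assume that $x$ is exactly representable in this arithmetic and $x\in[-1,1]$. Then $$|\tilde T_N(x)-T_N(x)| \le \epsilon_M\,\frac{3N(N-1)}{2} + O(\epsilon_M^2).$$ If $|x|\le s_N$, then $$|\tilde T_N(x)-T_N(x)| \le \epsilon_M\,\frac{9(N-1)}{2} + O(\epsilon_M^2).$$ Moreover, if $|x|\le s_N$ and $N$ is odd, then $$|\tilde T_N(x)-T_N(x)| \le \epsilon_M\,\frac{5(N-1)(N+7)}{8}\,|x| + O(\epsilon_M^2).$$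
   Context: $T_N(x)$ denotes the exact value of the Chebyshev polynomial of the first kind, defined by $T_0(x)=1$, $T_1(x)=x$, $T_n(x)=2xT_{n-1}(x)-T_{n-2}(x)$ for $n\ge 2$. Floating point model: each arithmetic operation returns the exact result of the operation on its computed operands times $(1+\delta)$ with $|\delta|\le\epsilon_M$; multiplication by $2$ is exact; there is no overflow or underflow. Thus the computed quantities are any real numbers with $\tilde T_0=1$, $\tilde T_1=x$ and, for $n=2,\ldots,N$, $$\tilde T_n = \bigl(2x\,\tilde T_{n-1}(1+\alpha_n)-\tilde T_{n-2}\bigr)(1+\beta_n),\qquad |\alpha_n|,|\beta_n|\le\epsilon_M.$$ $O(\epsilon_M^2)$ means: there exist $K,\epsilon_0>0$, depending only on $N$, such that for all $0<\epsilon_M\le\epsilon_0$, all admissible $x$ and all admissible rounding errors the term is bounded in absolute value by $K\epsilon_M^2$. *)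

theory Defs
  imports Complex_Main
begin

fun cheb_T :: "nat \<Rightarrow> real \<Rightarrow> real" where
  "cheb_T 0 x = 1"
| "cheb_T (Suc 0) x = x"
| "cheb_T (Suc (Suc n)) x = 2 * x * cheb_T (Suc n) x - cheb_T n x"

text \<open>
  The values \<open>T 0, \<dots>, T N\<close> are a possible outcome of the three-term recursion at \<open>x\<close> in floating
  point arithmetic with machine precision \<open>\<epsilon>\<close>: \<open>\<alpha> n\<close> is the relative error of the product and
  \<open>\<beta> n\<close> that of the subtraction in step \<open>n\<close>; multiplication by 2 is exact, and there is neither
  overflow nor underflow. Since \<open>x\<close> is exactly representable, \<open>T 1\<close> carries no error.
\<close>
definition fl_recursion :: "real \<Rightarrow> nat \<Rightarrow> real \<Rightarrow> (nat \<Rightarrow> real) \<Rightarrow> bool" where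
  "fl_recursion \<epsilon> N x T \<longleftrightarrow>
     T 0 = 1 \<and> T 1 = x \<and>
     (\<exists>\<alpha> \<beta>. \<forall>n\<in>{2..N}. \<bar>\<alpha> n\<bar> \<le> \<epsilon> \<and> \<bar>\<beta> n\<bar> \<le> \<epsilon> \<and>
        T n = (2 * x * T (n - 1) * (1 + \<alpha> n) - T (n - 2)) * (1 + \<beta> n))"

definition s :: "nat \<Rightarrow> real" where
  "s N = 1 / sqrt ((real N)\<^sup>2 + 1)"

end

theory Submission
  imports Defs
begin

text \<open>
  The error \<open>e n = T n - cheb_T n x\<close> satisfies the Chebyshev recursion with the local rounding
  error \<open>g n\<close> as inhomogeneity, hence \<open>e N = (\<Sum>k=2..N. U (N - k) x * g k)\<close>, where \<open>U\<close> are the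
  Chebyshev polynomials of the second kind. To first order in \<open>\<epsilon>\<close>, \<open>\<bar>g k\<bar>\<close> is at most
  \<open>\<epsilon> * (2 * \<bar>x\<bar> * \<bar>cheb_T (k - 1) x\<bar> + \<bar>cheb_T k x\<bar>)\<close>. It remains to insert
  \<open>\<bar>cheb_T n x\<bar> \<le> 1\<close>, \<open>\<bar>U n x\<bar> \<le> n + 1\<close> and, for small \<open>\<bar>x\<bar>\<close>, the Pell bound
  \<open>(1 - x\<^sup>2) * (U n x)\<^sup>2 \<le> 1\<close>; for odd \<open>n\<close> one has \<open>\<bar>cheb_T n x\<bar> \<le> n * \<bar>x\<bar>\<close> and
  \<open>\<bar>U n x\<bar> \<le> (n + 1) * \<bar>x\<bar>\<close>, and for odd \<open>N\<close> one of \<open>k\<close> and \<open>N - k\<close> is always odd.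
\<close>

section \<open>Chebyshev polynomials of both kinds: identities and bounds\<close>

fun cheb_U :: "nat \<Rightarrow> real \<Rightarrow> real" where
  "cheb_U 0 x = 1"
| "cheb_U (Suc 0) x = 2 * x"
| "cheb_U (Suc (Suc n)) x = 2 * x * cheb_U (Suc n) x - cheb_U n x"

text \<open>For \<open>x = cos t\<close> these are the addition formulas for sine (divided by
  \<open>sin t\<close>) and cosine at \<open>(n + 2) * t\<close>. They are proved together because
  each induction step uses both hypotheses.\<close>

lemma
  shows cheb_U_Suc: "cheb_U (Suc n) x = x * cheb_U n x + cheb_T (Suc n) x"
    and cheb_T_Suc_Suc: "cheb_T (Suc (Suc n)) x = x * cheb_T (Suc n) x - (1 - x\<^sup>2) * cheb_U n x"
proof (induction n)
  case (Suc n)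
  have "cheb_U (Suc (Suc n)) x = x * cheb_U (Suc n) x + (x * cheb_U (Suc n) x - cheb_U n x)"
    by simp
  also have "x * cheb_U (Suc n) x - cheb_U n x = cheb_T (Suc (Suc n)) x"
    unfolding Suc.IH by (simp add: algebra_simps power2_eq_square)
  finally show "cheb_U (Suc (Suc n)) x = x * cheb_U (Suc n) x + cheb_T (Suc (Suc n)) x" .
  have "cheb_T (Suc (Suc (Suc n))) x
      = x * cheb_T (Suc (Suc n)) x + (x * cheb_T (Suc (Suc n)) x - cheb_T (Suc n) x)"
    by simp
  also have "x * cheb_T (Suc (Suc n)) x - cheb_T (Suc n) x = - ((1 - x\<^sup>2) * cheb_U (Suc n) x)"
    unfolding Suc.IH by (simp add: algebra_simps power2_eq_square)
  finally show "cheb_T (Suc (Suc (Suc n))) x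
      = x * cheb_T (Suc (Suc n)) x - (1 - x\<^sup>2) * cheb_U (Suc n) x"
    by simp
qed (simp_all add: power2_eq_square)

text \<open>This is \<open>cos^2 + sin^2 = 1\<close> at the angle \<open>(n + 1) * t\<close>.
  Passing from \<open>n\<close> to \<open>Suc n\<close> is a rotation by \<open>t\<close>, which
  preserves the quadratic form \<open>a^2 + (1 - x^2) * b^2\<close>.\<close>

lemma cheb_pell: "(cheb_T (Suc n) x)\<^sup>2 + (1 - x\<^sup>2) * (cheb_U n x)\<^sup>2 = 1"
proof (induction n)
  case (Suc n)
  have "(cheb_T (Suc (Suc n)) x)\<^sup>2 + (1 - x\<^sup>2) * (cheb_U (Suc n) x)\<^sup>2
      = (x * cheb_T (Suc n) x - (1 - x\<^sup>2) * cheb_U n x)\<^sup>2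
        + (1 - x\<^sup>2) * (x * cheb_U n x + cheb_T (Suc n) x)\<^sup>2"
    by (simp only: cheb_T_Suc_Suc cheb_U_Suc)
  also have "\<dots> = (cheb_T (Suc n) x)\<^sup>2 + (1 - x\<^sup>2) * (cheb_U n x)\<^sup>2"
    by algebra
  finally show ?case
    using Suc.IH by simp
qed simp

lemma abs_cheb_T_le_1:
  assumes "\<bar>x\<bar> \<le> 1"
  shows "\<bar>cheb_T n x\<bar> \<le> 1"
proof (cases n)
  case (Suc m)
  have "x\<^sup>2 \<le> 1"
    using assms by (simp add: abs_square_le_1)
  then have "0 \<le> (1 - x\<^sup>2) * (cheb_U m x)\<^sup>2"
    by simp
  then have "(cheb_T n x)\<^sup>2 \<le> 1"
    using cheb_pell[of m x] Suc by simp
  then show ?thesis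
    by (simp add: abs_square_le_1)
qed simp

text \<open>By \<open>cheb_U_Suc\<close>, each step adds at most
  \<open>\<bar>cheb_T (Suc n) x\<bar> \<le> 1\<close>.\<close>

lemma abs_cheb_U_le:
  assumes "\<bar>x\<bar> \<le> 1"
  shows "\<bar>cheb_U n x\<bar> \<le> real n + 1"
proof (induction n)
  case (Suc n)
  have "\<bar>x * cheb_U n x\<bar> \<le> 1 * \<bar>cheb_U n x\<bar>"
    unfolding abs_mult using assms by (intro mult_right_mono) auto
  then show ?case
    using Suc.IH abs_cheb_T_le_1[OF assms, of "Suc n"] by (simp add: cheb_U_Suc)
qed simp

text \<open>The threshold \<open>1 / 5\<close> is \<open>(s 2)^2\<close>, the largest value of
  \<open>(s N)^2\<close> for \<open>N \<ge> 2\<close>. The Pell identity then gives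
  \<open>(cheb_U n x)^2 \<le> 5 / 4\<close>, and \<open>5 / 4\<close> is a rational upper bound for
  the square root.\<close>

lemma abs_cheb_U_le_of_sq:
  assumes "x\<^sup>2 \<le> 1 / 5"
  shows "\<bar>cheb_U n x\<bar> \<le> 5 / 4"
proof -
  have "4 / 5 * (cheb_U n x)\<^sup>2 \<le> (1 - x\<^sup>2) * (cheb_U n x)\<^sup>2"
    using assms by (intro mult_right_mono) auto
  also have "\<dots> \<le> 1"
    using cheb_pell[of n x] zero_le_power2[of "cheb_T (Suc n) x"] by linarith
  finally have "\<bar>cheb_U n x\<bar>\<^sup>2 \<le> (5 / 4)\<^sup>2"
    by (simp add: power2_eq_square)
  then show ?thesis
    by (rule power2_le_imp_le) simp
qed

text \<open>Going up by two indices adds \<open>2 * x\<close> times a value of modulus at most 1, so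
  the factor grows by only 2.\<close>

lemma abs_cheb_T_odd_le:
  assumes "\<bar>x\<bar> \<le> 1"
  shows "\<bar>cheb_T (2 * m + 1) x\<bar> \<le> (2 * real m + 1) * \<bar>x\<bar>"
proof (induction m)
  case (Suc m)
  have "\<bar>2 * x * cheb_T (2 * m + 2) x\<bar> \<le> 2 * \<bar>x\<bar> * 1"
    unfolding abs_mult by (intro mult_mono abs_cheb_T_le_1 assms) auto
  then show ?case
    using Suc.IH by (simp add: algebra_simps)
qed simp

text \<open>Double angle: \<open>2 * x^2 - 1 = cos (2 * t)\<close> for \<open>x = cos t\<close>, and
  \<open>sin (2 * t) = 2 * sin t * cos t\<close>. This splits off the factor \<open>x\<close>
  exactly; going up by two indices as for \<open>cheb_T\<close> would give a factor quadratic in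
  \<open>m\<close>, as \<open>cheb_U\<close> itself is bounded only linearly.\<close>

lemma cheb_U_odd: "cheb_U (2 * m + 1) x = 2 * x * cheb_U m (2 * x\<^sup>2 - 1)"
  by (induction m rule: induct_nat_012) (simp_all add: algebra_simps power2_eq_square)

lemma abs_cheb_U_odd_le:
  assumes "\<bar>x\<bar> \<le> 1"
  shows "\<bar>cheb_U (2 * m + 1) x\<bar> \<le> (2 * real m + 2) * \<bar>x\<bar>"
proof -
  have "\<bar>2 * x\<^sup>2 - 1\<bar> \<le> 1"
    using assms abs_square_le_1[of x] by (simp add: abs_le_iff)
  then have "2 * \<bar>x\<bar> * \<bar>cheb_U m (2 * x\<^sup>2 - 1)\<bar> \<le> 2 * \<bar>x\<bar> * (real m + 1)"
    by (intro mult_left_mono abs_cheb_U_le) auto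
  then show ?thesis
    by (simp only: cheb_U_odd abs_mult) (simp add: algebra_simps)
qed

section \<open>Propagation of local errors\<close>

text \<open>Discrete variation of constants: \<open>cheb_U (n - k) x\<close> is the response at
  index \<open>n\<close> to a unit perturbation at index \<open>k\<close>.\<close>

lemma cheb_recurrence_solution:
  fixes e g :: "nat \<Rightarrow> real"
  assumes "e 0 = 0" "e 1 = 0"
    and rec: "\<And>n. n \<in> {2..N} \<Longrightarrow> e n = 2 * x * e (n - 1) - e (n - 2) + g n"
    and "n \<le> N"
  shows "e n = (\<Sum>k=2..n. cheb_U (n - k) x * g k)"
  using \<open>n \<le> N\<close>
proof (induction n rule: induct_nat_012)
  case (ge2 n)
  have e: "e (Suc (Suc n)) = 2 * x * e (Suc n) - e n + g (Suc (Suc n))"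
    using rec[of "Suc (Suc n)"] ge2.prems by simp
  show ?case
  \<comment> \<open>For \<open>n = 0\<close> the range \<open>2..Suc n\<close> is empty, so there is
    no term \<open>k = Suc n\<close> to split off.\<close>
  proof (cases "n = 0")
    case True
    then show ?thesis
      using e assms(1,2) by (simp add: numeral_2_eq_2)
  next
    case False
    \<comment> \<open>For \<open>k \<le> n\<close> the weights obey the recursion of
      \<open>cheb_U\<close>; the two remaining terms carry \<open>cheb_U 1 x = 2 * x\<close> and
      \<open>cheb_U 0 x = 1\<close>.\<close>
    have "(\<Sum>k=2..n. cheb_U (Suc (Suc n) - k) x * g k)
        = (\<Sum>k=2..n. 2 * x * (cheb_U (Suc n - k) x * g k) - cheb_U (n - k) x * g k)"
      by (intro sum.cong) (auto simp: Suc_diff_le algebra_simps)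
    then show ?thesis
      using e ge2.IH ge2.prems False
      by (simp add: sum_subtractf sum_distrib_left algebra_simps)
  qed
qed (use assms(1,2) in auto)

text \<open>At most \<open>N\<close> terms with weights at most \<open>N\<close>. This crude bound
  enters only the constant of the second-order term.\<close>

lemma abs_cheb_U_sum_le:
  assumes "\<bar>x\<bar> \<le> 1" "n \<le> N" "0 \<le> c" "\<And>k. k \<in> {2..n} \<Longrightarrow> \<bar>g k\<bar> \<le> c"
  shows "\<bar>\<Sum>k=2..n. cheb_U (n - k) x * g k\<bar> \<le> (real N)\<^sup>2 * c"
proof -
  have "\<bar>\<Sum>k=2..n. cheb_U (n - k) x * g k\<bar> \<le> (\<Sum>k=2..n. \<bar>cheb_U (n - k) x * g k\<bar>)"
    by (rule sum_abs)
  also have "\<dots> \<le> real (card {2..n}) * (real N * c)"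
  proof (rule sum_bounded_above)
    fix k assume k: "k \<in> {2..n}"
    then have "\<bar>cheb_U (n - k) x\<bar> \<le> real N"
      using abs_cheb_U_le[OF assms(1), of "n - k"] \<open>n \<le> N\<close> by (simp add: of_nat_diff)
    then show "\<bar>cheb_U (n - k) x * g k\<bar> \<le> real N * c"
      unfolding abs_mult using k assms(4) by (intro mult_mono) auto
  qed
  also have "\<dots> \<le> real N * (real N * c)"
    using assms(2,3) by (intro mult_right_mono) auto
  finally show ?thesis
    by (simp add: power2_eq_square)
qed

section \<open>First-order analysis of the rounding errors\<close>

text \<open>The worst-case coefficient of \<open>\<epsilon>\<close> in the propagated error,
  obtained by letting all rounding errors have modulus \<open>\<epsilon>\<close> and adding absolute
  values. The three estimates of the theorem bound this one quantity.\<close>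

definition cheb_err_coeff :: "nat \<Rightarrow> real \<Rightarrow> real" where
  "cheb_err_coeff N x =
     (\<Sum>k=2..N. \<bar>cheb_U (N - k) x\<bar> * (2 * \<bar>x\<bar> * \<bar>cheb_T (k - 1) x\<bar> + \<bar>cheb_T k x\<bar>))"

lemma cheb_T_diff:
  assumes "2 \<le> n"
  shows "cheb_T n x = 2 * x * cheb_T (n - 1) x - cheb_T (n - 2) x"
proof -
  obtain m where "n = Suc (Suc m)"
    using assms by (metis add_2_eq_Suc le_Suc_ex)
  then show ?thesis
    by simp
qed

lemma abs_mult3_le:
  fixes a b c :: real
  assumes "\<bar>a\<bar> \<le> A" "\<bar>b\<bar> \<le> B" "\<bar>c\<bar> \<le> C"
  shows "\<bar>a * b * c\<bar> \<le> A * B * C"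
  unfolding abs_mult using assms by (intro mult_mono) auto

text \<open>Any bound depending on \<open>n\<close> alone would serve. Here
  \<open>\<bar>1 + \<alpha> n\<bar>\<close> and \<open>\<bar>1 + \<beta> n\<bar>\<close> are at most
  2, so a step gives at most \<open>2 * (4 * 10 + 1) * 10^n = 82 * 10^n\<close>.\<close>

lemma fl_recursion_bounded:
  fixes T :: "nat \<Rightarrow> real"
  assumes "\<bar>x\<bar> \<le> 1" "\<epsilon> \<le> 1" and T: "T 0 = 1" "T 1 = x"
    and rec: "\<And>n. n \<in> {2..N} \<Longrightarrow> \<bar>\<alpha> n\<bar> \<le> \<epsilon> \<and> \<bar>\<beta> n\<bar> \<le> \<epsilon> \<and>
        T n = (2 * x * T (n - 1) * (1 + \<alpha> n) - T (n - 2)) * (1 + \<beta> n)"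
    and "n \<le> N"
  shows "\<bar>T n\<bar> \<le> 10 ^ n"
  using \<open>n \<le> N\<close>
proof (induction n rule: induct_nat_012)
  case (ge2 n)
  define A where "A = 1 + \<alpha> (Suc (Suc n))"
  define B where "B = 1 + \<beta> (Suc (Suc n))"
  have AB: "\<bar>A\<bar> \<le> 2" "\<bar>B\<bar> \<le> 2"
    and Tn: "T (Suc (Suc n)) = (2 * x * T (Suc n) * A - T n) * B"
    using rec[of "Suc (Suc n)"] ge2.prems \<open>\<epsilon> \<le> 1\<close> by (auto simp: A_def B_def)
  have "\<bar>2 * x * T (Suc n) * A\<bar> \<le> 2 * 10 ^ Suc n * 2"
    using AB ge2 assms(1) by (intro abs_mult3_le) auto
  then have "\<bar>2 * x * T (Suc n) * A - T n\<bar> \<le> 41 * 10 ^ n"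
    using ge2 by simp
  then have "\<bar>T (Suc (Suc n))\<bar> \<le> 41 * 10 ^ n * 2"
    unfolding Tn abs_mult[of _ B] using AB by (intro mult_mono) auto
  then show ?case
    by simp
qed (use T \<open>\<bar>x\<bar> \<le> 1\<close> in auto)

text \<open>A bootstrap in two passes. Boundedness of the computed values makes the local errors,
  hence the total errors, of order \<open>\<epsilon>\<close>. Replacing computed by exact values in
  the local errors then costs only order \<open>\<epsilon>^2\<close>.\<close>

lemma fl_recursion_first_order:
  "\<exists>K>0. \<forall>\<epsilon> x T. 0 < \<epsilon> \<and> \<epsilon> \<le> 1 \<and> \<bar>x\<bar> \<le> 1 \<and> fl_recursion \<epsilon> N x T \<longrightarrow>
     \<bar>T N - cheb_T N x\<bar> \<le> \<epsilon> * cheb_err_coeff N x + K * \<epsilon>\<^sup>2"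
proof -
  \<comment> \<open>\<open>M\<close> bounds the computed values, \<open>7 * M * \<epsilon>\<close>
    the local errors, \<open>C * \<epsilon>\<close> the total errors and
    \<open>(5 * C + 2 * M) * \<epsilon>^2\<close> the second-order part of a local error. The final
    1 makes \<open>K\<close> positive for every \<open>N\<close>.\<close>
  define M :: real where "M = 10 ^ N"
  define C where "C = (real N)\<^sup>2 * (7 * M)"
  define K where "K = (real N)\<^sup>2 * (5 * C + 2 * M) + 1"
  have "0 < M" "0 \<le> C"
    by (simp_all add: M_def C_def)
  then have "0 < K"
    by (auto simp: K_def intro!: add_nonneg_pos mult_nonneg_nonneg)
  moreover have "\<bar>T N - cheb_T N x\<bar> \<le> \<epsilon> * cheb_err_coeff N x + K * \<epsilon>\<^sup>2"
    if "0 < \<epsilon>" "\<epsilon> \<le> 1" and x: "\<bar>x\<bar> \<le> 1" and fl: "fl_recursion \<epsilon> N x T" for \<epsilon> x T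
  proof -
    from fl obtain \<alpha> \<beta> where T: "T 0 = 1" "T 1 = x"
      and rec: "\<And>n. n \<in> {2..N} \<Longrightarrow> \<bar>\<alpha> n\<bar> \<le> \<epsilon> \<and> \<bar>\<beta> n\<bar> \<le> \<epsilon> \<and>
        T n = (2 * x * T (n - 1) * (1 + \<alpha> n) - T (n - 2)) * (1 + \<beta> n)"
      unfolding fl_recursion_def by blast
    have x2: "\<bar>2 * x\<bar> \<le> 2"
      using x by (simp add: abs_mult)
    \<comment> \<open>\<open>g\<close> is the defect of the computed values in the exact recursion;
      \<open>h\<close> is its linear part in the rounding errors, taken at the exact Chebyshev
      values.\<close>
    define e where "e n = T n - cheb_T n x" for n
    define g where "g n = T n - (2 * x * T (n - 1) - T (n - 2))" for n
    define h where "h n = 2 * x * cheb_T (n - 1) x * \<alpha> n + cheb_T n x * \<beta> n" for n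
    have TM: "\<bar>T n\<bar> \<le> M" if "n \<le> N" for n
    proof -
      have "\<bar>T n\<bar> \<le> 10 ^ n"
        using fl_recursion_bounded[OF x \<open>\<epsilon> \<le> 1\<close> T rec that] by simp
      also have "\<dots> \<le> M"
        unfolding M_def using that by (intro power_increasing) auto
      finally show ?thesis .
    qed
    have e_sum: "e n = (\<Sum>k=2..n. cheb_U (n - k) x * g k)" if "n \<le> N" for n
    proof (rule cheb_recurrence_solution[OF _ _ _ that])
      show "e n = 2 * x * e (n - 1) - e (n - 2) + g n" if "n \<in> {2..N}" for n
        using cheb_T_diff[of n x] that by (simp add: e_def g_def algebra_simps)
    qed (use T in \<open>auto simp: e_def\<close>)
    have g_eq: "g n = 2 * x * T (n - 1) * (\<alpha> n * (1 + \<beta> n)) + (2 * x * T (n - 1) - T (n - 2)) * \<beta> n"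
      if "n \<in> {2..N}" for n
      using rec[OF that] by (simp add: g_def algebra_simps)
    have g_le: "\<bar>g n\<bar> \<le> 7 * M * \<epsilon>" if n: "n \<in> {2..N}" for n
    proof -
      have TT: "\<bar>T (n - 1)\<bar> \<le> M" "\<bar>T (n - 2)\<bar> \<le> M"
        using TM n by auto
      have \<alpha>\<beta>: "\<bar>\<alpha> n\<bar> \<le> \<epsilon>" "\<bar>\<beta> n\<bar> \<le> \<epsilon>"
        using rec[OF n] by auto
      have "\<bar>\<alpha> n * (1 + \<beta> n)\<bar> \<le> \<epsilon> * 2"
        unfolding abs_mult using \<alpha>\<beta> \<open>\<epsilon> \<le> 1\<close> by (intro mult_mono) auto
      then have 1: "\<bar>2 * x * T (n - 1) * (\<alpha> n * (1 + \<beta> n))\<bar> \<le> 2 * M * (\<epsilon> * 2)"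
        using x2 TT by (intro abs_mult3_le) auto
      have 2: "\<bar>2 * x * T (n - 1) * \<beta> n\<bar> \<le> 2 * M * \<epsilon>"
        using x2 TT \<alpha>\<beta> by (intro abs_mult3_le) auto
      have 3: "\<bar>T (n - 2) * \<beta> n\<bar> \<le> M * \<epsilon>"
        unfolding abs_mult using TT \<alpha>\<beta> by (intro mult_mono) auto
      have "g n = 2 * x * T (n - 1) * (\<alpha> n * (1 + \<beta> n)) + 2 * x * T (n - 1) * \<beta> n
          - T (n - 2) * \<beta> n"
        by (simp add: g_eq[OF n] left_diff_distrib)
      then show ?thesis
        using 1 2 3 by linarith
    qed
    have e_le: "\<bar>e n\<bar> \<le> C * \<epsilon>" if "n \<le> N" for n
    proof -
      have "\<bar>e n\<bar> \<le> (real N)\<^sup>2 * (7 * M * \<epsilon>)"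
        unfolding e_sum[OF that] using x that \<open>0 < M\<close> \<open>0 < \<epsilon>\<close> g_le
        by (intro abs_cheb_U_sum_le) auto
      then show ?thesis
        by (simp add: C_def mult.assoc)
    qed
    have gh_le: "\<bar>g n - h n\<bar> \<le> (5 * C + 2 * M) * \<epsilon>\<^sup>2" if n: "n \<in> {2..N}" for n
    proof -
      have bounds: "\<bar>T (n - 1)\<bar> \<le> M" "\<bar>e (n - 1)\<bar> \<le> C * \<epsilon>" "\<bar>e (n - 2)\<bar> \<le> C * \<epsilon>"
        using TM e_le n by auto
      have \<alpha>\<beta>: "\<bar>\<alpha> n\<bar> \<le> \<epsilon>" "\<bar>\<beta> n\<bar> \<le> \<epsilon>"
        using rec[OF n] by auto
      have 1: "\<bar>2 * x * e (n - 1) * \<alpha> n\<bar> \<le> 2 * (C * \<epsilon>) * \<epsilon>"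
        using x2 bounds \<alpha>\<beta> by (intro abs_mult3_le) auto
      have 2: "\<bar>2 * x * e (n - 1) * \<beta> n\<bar> \<le> 2 * (C * \<epsilon>) * \<epsilon>"
        using x2 bounds \<alpha>\<beta> by (intro abs_mult3_le) auto
      have "\<bar>\<alpha> n * \<beta> n\<bar> \<le> \<epsilon> * \<epsilon>"
        unfolding abs_mult using \<alpha>\<beta> by (intro mult_mono) auto
      then have 3: "\<bar>2 * x * T (n - 1) * (\<alpha> n * \<beta> n)\<bar> \<le> 2 * M * (\<epsilon> * \<epsilon>)"
        using x2 bounds by (intro abs_mult3_le) auto
      have 4: "\<bar>e (n - 2) * \<beta> n\<bar> \<le> C * \<epsilon> * \<epsilon>"
        unfolding abs_mult using bounds \<alpha>\<beta> by (intro mult_mono) auto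
      have cheb_n: "cheb_T n x = 2 * x * cheb_T (n - 1) x - cheb_T (n - 2) x"
        using n by (intro cheb_T_diff) auto
      \<comment> \<open>Every term is of second order: three pair a total error with a rounding
        error, one contains \<open>\<alpha> n * \<beta> n\<close>.\<close>
      have "g n - h n = 2 * x * e (n - 1) * \<alpha> n + 2 * x * e (n - 1) * \<beta> n
          + 2 * x * T (n - 1) * (\<alpha> n * \<beta> n) - e (n - 2) * \<beta> n"
        by (simp add: g_eq[OF n] h_def e_def cheb_n algebra_simps)
      also have "\<bar>\<dots>\<bar> \<le> 2 * (C * \<epsilon>) * \<epsilon> + 2 * (C * \<epsilon>) * \<epsilon> + 2 * M * (\<epsilon> * \<epsilon>) + C * \<epsilon> * \<epsilon>"
        using 1 2 3 4 by linarith
      finally show ?thesis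
        by (simp add: algebra_simps power2_eq_square)
    qed
    have "\<bar>\<Sum>k=2..N. cheb_U (N - k) x * h k\<bar> \<le> (\<Sum>k=2..N. \<bar>cheb_U (N - k) x * h k\<bar>)"
      by (rule sum_abs)
    also have "\<dots> \<le> (\<Sum>k=2..N. \<epsilon> * (\<bar>cheb_U (N - k) x\<bar> *
        (2 * \<bar>x\<bar> * \<bar>cheb_T (k - 1) x\<bar> + \<bar>cheb_T k x\<bar>)))"
    proof (rule sum_mono)
      fix k assume k: "k \<in> {2..N}"
      have "\<bar>h k\<bar> \<le> 2 * \<bar>x\<bar> * \<bar>cheb_T (k - 1) x\<bar> * \<bar>\<alpha> k\<bar> + \<bar>cheb_T k x\<bar> * \<bar>\<beta> k\<bar>"
        unfolding h_def by (rule order_trans[OF abs_triangle_ineq]) (simp add: abs_mult)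
      also have "\<dots> \<le> 2 * \<bar>x\<bar> * \<bar>cheb_T (k - 1) x\<bar> * \<epsilon> + \<bar>cheb_T k x\<bar> * \<epsilon>"
        using rec[OF k] by (intro add_mono mult_left_mono) auto
      finally have "\<bar>cheb_U (N - k) x\<bar> * \<bar>h k\<bar> \<le> \<bar>cheb_U (N - k) x\<bar> *
          (2 * \<bar>x\<bar> * \<bar>cheb_T (k - 1) x\<bar> * \<epsilon> + \<bar>cheb_T k x\<bar> * \<epsilon>)"
        by (intro mult_left_mono) auto
      then show "\<bar>cheb_U (N - k) x * h k\<bar> \<le> \<epsilon> * (\<bar>cheb_U (N - k) x\<bar> *
          (2 * \<bar>x\<bar> * \<bar>cheb_T (k - 1) x\<bar> + \<bar>cheb_T k x\<bar>))"
        by (simp add: abs_mult algebra_simps)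
    qed
    finally have main: "\<bar>\<Sum>k=2..N. cheb_U (N - k) x * h k\<bar> \<le> \<epsilon> * cheb_err_coeff N x"
      by (simp add: cheb_err_coeff_def sum_distrib_left)
    have rest: "\<bar>\<Sum>k=2..N. cheb_U (N - k) x * (g k - h k)\<bar> \<le> (real N)\<^sup>2 * ((5 * C + 2 * M) * \<epsilon>\<^sup>2)"
      using x gh_le \<open>0 < M\<close> \<open>0 \<le> C\<close> by (intro abs_cheb_U_sum_le) auto
    have "e N = (\<Sum>k=2..N. cheb_U (N - k) x * h k) + (\<Sum>k=2..N. cheb_U (N - k) x * (g k - h k))"
      by (simp add: e_sum sum.distrib[symmetric] algebra_simps)
    moreover have "(real N)\<^sup>2 * ((5 * C + 2 * M) * \<epsilon>\<^sup>2) \<le> K * \<epsilon>\<^sup>2"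
      by (simp add: K_def algebra_simps)
    ultimately show ?thesis
      using main rest unfolding e_def by linarith
  qed
  ultimately show ?thesis
    by blast
qed

section \<open>Bounds for the first-order coefficient\<close>

lemma cheb_err_coeff_le:
  assumes "\<bar>x\<bar> \<le> 1" "2 \<le> N"
  shows "cheb_err_coeff N x \<le> 3 * real N * (real N - 1) / 2"
proof -
  have "cheb_err_coeff N x \<le> (\<Sum>k=2..N. (real N - real k + 1) * 3)"
    unfolding cheb_err_coeff_def
  proof (rule sum_mono)
    fix k assume "k \<in> {2..N}"
    then have "\<bar>cheb_U (N - k) x\<bar> \<le> real N - real k + 1"
      using abs_cheb_U_le[OF assms(1), of "N - k"] by (simp add: of_nat_diff)
    moreover have "\<bar>x\<bar> * \<bar>cheb_T (k - 1) x\<bar> \<le> 1 * 1"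
      using assms(1) abs_cheb_T_le_1[OF assms(1)] by (intro mult_mono) auto
    then have "2 * \<bar>x\<bar> * \<bar>cheb_T (k - 1) x\<bar> + \<bar>cheb_T k x\<bar> \<le> 3"
      using abs_cheb_T_le_1[OF assms(1), of k] by simp
    ultimately show "\<bar>cheb_U (N - k) x\<bar> * (2 * \<bar>x\<bar> * \<bar>cheb_T (k - 1) x\<bar> + \<bar>cheb_T k x\<bar>)
        \<le> (real N - real k + 1) * 3"
      by (intro mult_mono) auto
  qed
  also have "\<dots> = 3 * real N * (real N - 1) / 2"
  proof -
    \<comment> \<open>\<open>N\<close> occurs both as upper limit and in the summand; the induction
      needs the two separated.\<close>
    have "(\<Sum>k=2..n. (c - real k + 1) * 3) = 3 * (real n - 1) * (2 * c - real n) / 2"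
      if "1 \<le> n" for n and c :: real
      using that by (induction n rule: dec_induct) (simp_all add: field_simps)
    from this[of N "real N"] show ?thesis
      using assms(2) by simp
  qed
  finally show ?thesis .
qed

lemma s_bound:
  assumes "\<bar>x\<bar> \<le> s N"
  shows "x\<^sup>2 * ((real N)\<^sup>2 + 1) \<le> 1"
proof -
  have "\<bar>x\<bar>\<^sup>2 \<le> (s N)\<^sup>2"
    using assms by (intro power_mono) auto
  also have "(s N)\<^sup>2 = 1 / ((real N)\<^sup>2 + 1)"
    by (simp add: s_def power_divide)
  finally show ?thesis
    by (simp add: field_simps add_pos_nonneg)
qed

lemma sq_le_of_s_bound:
  assumes "\<bar>x\<bar> \<le> s N" "2 \<le> N"
  shows "x\<^sup>2 \<le> 1 / 5"
proof -
  have "2\<^sup>2 \<le> (real N)\<^sup>2"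
    using assms(2) by (intro power_mono) auto
  then have "x\<^sup>2 * 5 \<le> x\<^sup>2 * ((real N)\<^sup>2 + 1)"
    by (intro mult_left_mono) auto
  then show ?thesis
    using s_bound[OF assms(1)] by linarith
qed

text \<open>Each of the \<open>N - 1\<close> terms is at most \<open>5 / 4 * 2\<close>: the weight
  by the Pell bound, the local factor because \<open>\<bar>x\<bar> \<le> 1 / 2\<close>. Since
  \<open>5 / 2 \<le> 9 / 2\<close>, this suffices.\<close>

lemma cheb_err_coeff_le_small:
  assumes "\<bar>x\<bar> \<le> s N" "2 \<le> N"
  shows "cheb_err_coeff N x \<le> 9 * (real N - 1) / 2"
proof -
  note sq = sq_le_of_s_bound[OF assms]
  have "\<bar>x\<bar>\<^sup>2 \<le> (1 / 2)\<^sup>2"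
    using sq by (simp add: power2_eq_square)
  then have x: "\<bar>x\<bar> \<le> 1 / 2"
    by (rule power2_le_imp_le) simp
  then have x1: "\<bar>x\<bar> \<le> 1"
    by simp
  have "cheb_err_coeff N x \<le> real (card {2..N}) * (5 / 4 * 2)"
    unfolding cheb_err_coeff_def
  proof (rule sum_bounded_above)
    fix k
    have "\<bar>x\<bar> * \<bar>cheb_T (k - 1) x\<bar> \<le> 1 / 2 * 1"
      using x abs_cheb_T_le_1[OF x1] by (intro mult_mono) auto
    then have "2 * \<bar>x\<bar> * \<bar>cheb_T (k - 1) x\<bar> + \<bar>cheb_T k x\<bar> \<le> 2"
      using abs_cheb_T_le_1[OF x1, of k] by simp
    then show "\<bar>cheb_U (N - k) x\<bar> * (2 * \<bar>x\<bar> * \<bar>cheb_T (k - 1) x\<bar> + \<bar>cheb_T k x\<bar>) \<le> 5 / 4 * 2"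
      using abs_cheb_U_le_of_sq[OF sq] by (intro mult_mono) auto
  qed
  also have "\<dots> \<le> 9 * (real N - 1) / 2"
    using assms(2) by (simp add: of_nat_diff)
  finally show ?thesis .
qed

text \<open>The terms are paired as \<open>k = 2 * j\<close> and \<open>k = 2 * j + 1\<close>. In
  the first the factor \<open>\<bar>x\<bar>\<close> comes from the weight, whose index
  \<open>N - k\<close> is odd; in the second it comes from the local factor, while the weight is at
  most \<open>5 / 4\<close>.\<close>

lemma cheb_err_coeff_le_small_odd:
  assumes "\<bar>x\<bar> \<le> s N" "2 \<le> N" "odd N"
  shows "cheb_err_coeff N x \<le> 5 * (real N - 1) * (real N + 7) / 8 * \<bar>x\<bar>"
proof -
  obtain m where N: "N = 2 * m + 1"
    using \<open>odd N\<close> by (rule oddE)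
  then have m: "1 \<le> m"
    using \<open>2 \<le> N\<close> by simp
  then have "1 \<le> real m"
    by simp
  note sq = sq_le_of_s_bound[OF assms(1,2)]
  have x: "\<bar>x\<bar> \<le> 1"
    using sq by (simp add: abs_square_le_1[symmetric])
  \<comment> \<open>Since \<open>2 * m = N - 1\<close>, the condition on \<open>x\<close> gives
    \<open>2 * m * \<bar>x\<bar> \<le> 1\<close>, which later absorbs the contribution quadratic in
    \<open>\<bar>x\<bar>\<close>.\<close>
  have "(2 * real m * \<bar>x\<bar>)\<^sup>2 = x\<^sup>2 * (2 * real m)\<^sup>2"
    by (simp add: power_mult_distrib)
  also have "\<dots> \<le> x\<^sup>2 * ((real N)\<^sup>2 + 1)"
    unfolding N by (intro mult_left_mono) (auto simp: power2_eq_square algebra_simps)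
  also have "\<dots> \<le> 1\<^sup>2"
    using s_bound[OF assms(1)] by simp
  finally have mx: "2 * real m * \<bar>x\<bar> \<le> 1"
    by (rule power2_le_imp_le) simp
  define f where "f k = \<bar>cheb_U (N - k) x\<bar> * (2 * \<bar>x\<bar> * \<bar>cheb_T (k - 1) x\<bar> + \<bar>cheb_T k x\<bar>)" for k
  have pairs: "(\<Sum>k=2..2 * l + 1. f k) = (\<Sum>j=1..l. f (2 * j) + f (2 * j + 1))" for l
    by (induction l) simp_all
  have even: "f (2 * j) \<le> 2 * (real m - real j + 1) * (\<bar>x\<bar> * (1 + 2 * \<bar>x\<bar>))"
    if "j \<in> {1..m}" for j
  proof -
    have "N - 2 * j = 2 * (m - j) + 1"
      using that N by auto
    then have "\<bar>cheb_U (N - 2 * j) x\<bar> \<le> 2 * (real m - real j + 1) * \<bar>x\<bar>"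
      using abs_cheb_U_odd_le[OF x, of "m - j"] that by (simp add: of_nat_diff algebra_simps)
    moreover have "2 * \<bar>x\<bar> * \<bar>cheb_T (2 * j - 1) x\<bar> \<le> 2 * \<bar>x\<bar> * 1"
      using abs_cheb_T_le_1[OF x] by (intro mult_left_mono) auto
    then have "2 * \<bar>x\<bar> * \<bar>cheb_T (2 * j - 1) x\<bar> + \<bar>cheb_T (2 * j) x\<bar> \<le> 1 + 2 * \<bar>x\<bar>"
      using abs_cheb_T_le_1[OF x, of "2 * j"] by linarith
    ultimately show ?thesis
      unfolding f_def mult.assoc[of _ "\<bar>x\<bar>" "1 + 2 * \<bar>x\<bar>", symmetric]
      using that by (intro mult_mono) auto
  qed
  have odd: "f (2 * j + 1) \<le> (2 * real j + 3) * (\<bar>x\<bar> * 5 / 4)" for j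
  proof -
    have "2 * \<bar>x\<bar> * \<bar>cheb_T (2 * j) x\<bar> \<le> 2 * \<bar>x\<bar> * 1"
      using abs_cheb_T_le_1[OF x] by (intro mult_left_mono) auto
    then have "2 * \<bar>x\<bar> * \<bar>cheb_T (2 * j) x\<bar> + \<bar>cheb_T (2 * j + 1) x\<bar> \<le> (2 * real j + 3) * \<bar>x\<bar>"
      using abs_cheb_T_odd_le[OF x, of j] by (simp add: algebra_simps)
    then have "f (2 * j + 1) \<le> 5 / 4 * ((2 * real j + 3) * \<bar>x\<bar>)"
      unfolding f_def using abs_cheb_U_le_of_sq[OF sq] by (intro mult_mono) auto
    then show ?thesis
      by (simp add: algebra_simps)
  qed
  have "cheb_err_coeff N x = (\<Sum>j=1..m. f (2 * j) + f (2 * j + 1))"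
    unfolding pairs[symmetric] by (simp add: cheb_err_coeff_def f_def N)
  also have "\<dots> \<le> (\<Sum>j=1..m. 2 * (real m - real j + 1) * (\<bar>x\<bar> * (1 + 2 * \<bar>x\<bar>))
      + (2 * real j + 3) * (\<bar>x\<bar> * 5 / 4))"
    by (intro sum_mono add_mono even odd)
  also have "\<dots> = (\<Sum>j=1..m. 2 * (real m - real j + 1)) * (\<bar>x\<bar> * (1 + 2 * \<bar>x\<bar>))
      + (\<Sum>j=1..m. 2 * real j + 3) * (\<bar>x\<bar> * 5 / 4)"
    unfolding sum_distrib_right by (rule sum.distrib)
  also have "(\<Sum>j=1..m. 2 * (real m - real j + 1)) = real m * (real m + 1)"
  proof -
    have "(\<Sum>j=1..l. 2 * (c - real j + 1)) = real l * (2 * c - real l + 1)" for l and c :: real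
      by (induction l) (simp_all add: algebra_simps)
    from this[of "real m" m] show ?thesis
      by simp
  qed
  also have "(\<Sum>j=1..m. 2 * real j + 3) = real m * (real m + 4)"
    by (induction m) (simp_all add: algebra_simps)
  also have "real m * (real m + 1) * (\<bar>x\<bar> * (1 + 2 * \<bar>x\<bar>)) + real m * (real m + 4) * (\<bar>x\<bar> * 5 / 4)
      = (real m * (real m + 1) * (1 + 2 * \<bar>x\<bar>) + 5 / 4 * (real m * (real m + 4))) * \<bar>x\<bar>"
    by (simp add: algebra_simps)
  also have "\<dots> \<le> 5 * (real N - 1) * (real N + 7) / 8 * \<bar>x\<bar>"
  proof (rule mult_right_mono)
    have "real m * (real m + 1) * (1 + 2 * \<bar>x\<bar>)
        = real m * (real m + 1) + (real m + 1) * (2 * real m * \<bar>x\<bar>)"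
      by (simp add: algebra_simps)
    also have "\<dots> \<le> real m * (real m + 1) + (real m + 1) * 1"
      using mx by (intro add_left_mono mult_left_mono) auto
    finally have "real m * (real m + 1) * (1 + 2 * \<bar>x\<bar>) + 5 / 4 * (real m * (real m + 4))
        \<le> real m * (real m + 1) + (real m + 1) * 1 + 5 / 4 * (real m * (real m + 4))"
      by simp
    \<comment> \<open>With \<open>N = 2 * m + 1\<close> the target is
      \<open>5 / 2 * m * (m + 4)\<close>; the slack \<open>m^2 / 4 + 3 * m - 1\<close> is positive
      as \<open>m \<ge> 1\<close>.\<close>
    also have "\<dots> = 5 * (real N - 1) * (real N + 7) / 8 - ((real m)\<^sup>2 / 4 + (3 * real m - 1))"
      by (simp add: N field_simps power2_eq_square)
    also have "\<dots> \<le> 5 * (real N - 1) * (real N + 7) / 8"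
      using \<open>1 \<le> real m\<close> zero_le_power2[of "real m"] by linarith
    finally show "real m * (real m + 1) * (1 + 2 * \<bar>x\<bar>) + 5 / 4 * (real m * (real m + 4))
        \<le> 5 * (real N - 1) * (real N + 7) / 8" .
  qed simp
  finally show ?thesis .
qed

theorem theorem3:
  fixes N :: nat
  assumes "N \<ge> 2"
  shows "(\<exists>K>0. \<exists>\<epsilon>0>0. \<forall>\<epsilon> x T.
            0 < \<epsilon> \<and> \<epsilon> \<le> \<epsilon>0 \<and> x \<in> {-1..1} \<and> fl_recursion \<epsilon> N x T \<longrightarrow>
            \<bar>T N - cheb_T N x\<bar> \<le> \<epsilon> * (3 * real N * (real N - 1) / 2) + K * \<epsilon>\<^sup>2) \<and>
         (\<exists>K>0. \<exists>\<epsilon>0>0. \<forall>\<epsilon> x T.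
            0 < \<epsilon> \<and> \<epsilon> \<le> \<epsilon>0 \<and> x \<in> {-1..1} \<and> \<bar>x\<bar> \<le> s N \<and> fl_recursion \<epsilon> N x T \<longrightarrow>
            \<bar>T N - cheb_T N x\<bar> \<le> \<epsilon> * (9 * (real N - 1) / 2) + K * \<epsilon>\<^sup>2) \<and>
         (odd N \<longrightarrow> (\<exists>K>0. \<exists>\<epsilon>0>0. \<forall>\<epsilon> x T.
            0 < \<epsilon> \<and> \<epsilon> \<le> \<epsilon>0 \<and> x \<in> {-1..1} \<and> \<bar>x\<bar> \<le> s N \<and> fl_recursion \<epsilon> N x T \<longrightarrow>
            \<bar>T N - cheb_T N x\<bar> \<le> \<epsilon> * (5 * (real N - 1) * (real N + 7) / 8) * \<bar>x\<bar> + K * \<epsilon>\<^sup>2))"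
proof -
  obtain K where K: "K > 0" and err: "\<And>\<epsilon> x T. 0 < \<epsilon> \<Longrightarrow> \<epsilon> \<le> 1 \<Longrightarrow> \<bar>x\<bar> \<le> 1 \<Longrightarrow> fl_recursion \<epsilon> N x T \<Longrightarrow>
      \<bar>T N - cheb_T N x\<bar> \<le> \<epsilon> * cheb_err_coeff N x + K * \<epsilon>\<^sup>2"
    using fl_recursion_first_order[of N] by blast
  have bound: "\<bar>T N - cheb_T N x\<bar> \<le> \<epsilon> * B + K * \<epsilon>\<^sup>2"
    if "0 < \<epsilon>" "\<epsilon> \<le> 1" "x \<in> {-1..1}" "fl_recursion \<epsilon> N x T" "cheb_err_coeff N x \<le> B" for \<epsilon> x T B
  proof -
    have "\<epsilon> * cheb_err_coeff N x \<le> \<epsilon> * B"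
      using that by (intro mult_left_mono) auto
    moreover have "\<bar>x\<bar> \<le> 1"
      using that by auto
    ultimately show ?thesis
      using err[of \<epsilon> x T] that by linarith
  qed
  \<comment> \<open>One \<open>K\<close> and the threshold 1 for \<open>\<epsilon>\<close> serve all
    three claims, which differ only in the bound for \<open>cheb_err_coeff\<close>.\<close>
  show ?thesis
  proof (intro conjI impI; rule exI[of _ K], rule conjI[OF K], rule exI[of _ 1],
      intro conjI allI impI; (elim conjE)?)
    fix \<epsilon> x :: real and T
    assume *: "0 < \<epsilon>" "\<epsilon> \<le> 1" "x \<in> {-1..1}" "fl_recursion \<epsilon> N x T"
    show "\<bar>T N - cheb_T N x\<bar> \<le> \<epsilon> * (3 * real N * (real N - 1) / 2) + K * \<epsilon>\<^sup>2"
      using * assms by (intro bound cheb_err_coeff_le) auto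
    assume x: "\<bar>x\<bar> \<le> s N"
    show "\<bar>T N - cheb_T N x\<bar> \<le> \<epsilon> * (9 * (real N - 1) / 2) + K * \<epsilon>\<^sup>2"
      using * x assms by (intro bound cheb_err_coeff_le_small) auto
    assume "odd N"
    then show "\<bar>T N - cheb_T N x\<bar> \<le> \<epsilon> * (5 * (real N - 1) * (real N + 7) / 8) * \<bar>x\<bar> + K * \<epsilon>\<^sup>2"
      using bound[OF * cheb_err_coeff_le_small_odd[OF x assms]] by (simp add: mult.assoc)
  qed simp_all
qed

end
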